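(* Let $P$ be a set of primes and let $B=\langle P\rangle$ be the set of integers of Beurling type corresponding to $P$. Let $N_P(x)$ be the counting function of $B$, and suppose that $$N_P(x)=cx+O\left(\frac{x}{(\log x)^{\lambda}}\right)\quad (x\to\infty)$$ for some constants $c>0$ and $\lambda>0$. Then for every $\epsilon$ with $0<\epsilon<1$ there exists a subset $B_\epsilon\subseteq B$, depending only on $\epsilon$ (for the given $B$) and having positive asymptotic density, such that for all integers $s\ge 1$ and $r\ge 2$ and all $k\in B_\epsilon$ with $k\ge 2$, $$\left|\frac{1}{k^{s(r+1)}}\sum_{j=1}^{k^s}j^r c_k^{(s)}(j)-\left(\frac{J_s(k)}{k^s}-\frac{1}{r+1}\right)\right|<\epsilon .$$
   Context: For positive integers $a,b,s$, the generalized GCD $(a,b)_s$ is the largest $d^s$ with $d\in\mathbb{N}$ such that $d^s\mid a$ and $d^s\mid b$. For positive integers $k,s$ and an integer $j$, the generalized (Cohen) Ramanujan sum is $$c_k^{(s)}(j)=\sum_{\substack{1\le m\le k^s\\ (m,k^s)_s=1}}e^{2\pi i jm/k^s}.$$ The Jordan totient function is $J_s(n)=n^s\prod_{p\mid n}\left(1-p^{-s}\right)$, the product being over primes $p$ dividing $n$. For a set $P$ of primes, the set of integers of Beurling type corresponding to $P$ is the multiplicative semigroup $\langle P\rangle=\{\prod_{j=1}^{t}p_j^{a_j}: t\ge 1,\ a_j\ge 0,\ p_j\in P\}$, with $\langle\emptyset\rangle=\{1\}$. The counting function of a set $A$ of integers is $A(x)=\#\{a\in A:1\le a\le x\}$,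 and $A$ has asymptotic density $\alpha$ if $\lim_{x\to\infty}A(x)/x=\alpha$. *)

theory Defs
  imports
    Complex_Main
    "HOL-Computational_Algebra.Primes"
    "HOL-Library.Landau_Symbols"
begin

text \<open>Intended for \<open>a, b, s \<ge> 1\<close>, where the set is finite and contains 1.\<close>

definition gen_gcd :: "nat \<Rightarrow> nat \<Rightarrow> nat \<Rightarrow> nat" where
  "gen_gcd s a b = Max {d ^ s | d. d \<ge> 1 \<and> d ^ s dvd a \<and> d ^ s dvd b}"

definition cohen_ramanujan_sum :: "nat \<Rightarrow> nat \<Rightarrow> int \<Rightarrow> complex" where
  "cohen_ramanujan_sum s k j =
     (\<Sum>m | 1 \<le> m \<and> m \<le> k ^ s \<and> gen_gcd s m (k ^ s) = 1.
        exp (2 * of_real pi * \<i> * of_int j * of_nat m / of_nat (k ^ s)))"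

definition jordan_totient :: "nat \<Rightarrow> nat \<Rightarrow> real" where
  "jordan_totient s n = real n ^ s * (\<Prod>p | prime p \<and> p dvd n. 1 - 1 / real p ^ s)"

definition beurling_integers :: "nat set \<Rightarrow> nat set" where
  "beurling_integers P =
     (if P = {} then {1}
      else {\<Prod>j = 1..t. p j ^ a j | (t::nat) p (a :: nat \<Rightarrow> nat).
              t \<ge> 1 \<and> (\<forall>j \<in> {1..t}. p j \<in> P)})"

definition counting_fun :: "nat set \<Rightarrow> real \<Rightarrow> real" where
  "counting_fun A x = real (card {a \<in> A. 1 \<le> a \<and> real a \<le> x})"

definition has_asymptotic_density :: "nat set \<Rightarrow> real \<Rightarrow> bool" where
  "has_asymptotic_density A \<alpha> \<longleftrightarrow> ((\<lambda>x. counting_fun A x / x) \<longlongrightarrow> \<alpha>) at_top"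

end

theory Submission
  imports Defs "HOL-Analysis.Complex_Transcendental"
begin

text \<open>
  Sieving out the primes dividing \<open>k\<close> writes \<open>c\<^sub>k(j)\<close> as an alternating sum, over squarefree divisors
  \<open>t\<close> of \<open>k\<close>, of \<open>(k / t) ^ s\<close> times the indicator of \<open>(k / t) ^ s dvd j\<close>. The normalised moment thus
  becomes the alternating sum of the means of \<open>(i / t ^ s) ^ r\<close> over \<open>1 \<le> i \<le> t ^ s\<close>. These lie between
  \<open>1 / (r + 1)\<close> and \<open>1 / (r + 1) + 1 / t ^ s\<close>, so \<open>t = 1\<close> gives the main term and the error is at most
  \<open>\<Prod> (1 + 1 / p) - 1 \<le> exp (\<Sum> 1 / p) - 1\<close> over the primes \<open>p\<close> dividing \<open>k\<close>, uniformly in \<open>r\<close> and \<open>s\<close>.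

  It remains to find a set of positive density in \<open>B\<close> on which \<open>\<Sum> 1 / p\<close> is small. The set of \<open>k\<close> with
  \<open>\<Sum> 1 / p < \<eta>\<close> need not obviously have a density, so we sieve instead: keep the \<open>k\<close> whose prime
  factors all exceed \<open>2 ^ N\<close> and which, for each \<open>j \<ge> N\<close>, are divisible by no product of \<open>j\<close> distinct
  integers from \<open>(2 ^ j, 2 ^ (j + 1)]\<close>. The reciprocals of all these products have a finite sum, which
  yields the existence of the density; the first condition costs a factor of at most \<open>2 ^ N\<close> and the
  second at most \<open>e / N!\<close>, so the density is positive for large \<open>N\<close>.
\<close>

subsection \<open>Moments of Cohen--Ramanujan sums\<close>

text \<open>If some \<open>d > 1\<close> has \<open>d ^ s\<close> dividing both arguments, then
  \<open>d dvd k\<close> because \<open>s \<ge> 1\<close>, and a prime factor of \<open>d\<close> is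
  one of \<open>k\<close>. The sieve therefore runs over the primes of \<open>k\<close>
  alone.\<close>

lemma gen_gcd_power_eq_1_iff:
  assumes "s \<ge> 1" "k \<ge> 1" "m \<ge> 1"
  shows "gen_gcd s m (k ^ s) = 1 \<longleftrightarrow> (\<forall>p\<in>prime_factors k. \<not> p ^ s dvd m)"
proof -
  define D where "D = {d ^ s | d. d \<ge> 1 \<and> d ^ s dvd m \<and> d ^ s dvd k ^ s}"
  have "D \<subseteq> {..m}"
    using assms by (auto simp: D_def dvd_imp_le)
  then have fin: "finite D"
    by (rule finite_subset) simp
  have "1 \<in> D"
    by (auto simp: D_def intro!: exI[of _ 1])
  have gcd: "gen_gcd s m (k ^ s) = Max D"
    by (simp add: gen_gcd_def D_def)
  show ?thesis
  proof
    assume one: "gen_gcd s m (k ^ s) = 1"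
    show "\<forall>p\<in>prime_factors k. \<not> p ^ s dvd m"
    proof (intro ballI notI)
      fix p assume p: "p \<in> prime_factors k" "p ^ s dvd m"
      then have "prime p" "p dvd k"
        by (auto simp: in_prime_factors_iff)
      then have "p ^ s \<in> D"
        using p prime_ge_1_nat by (auto simp: D_def dvd_power_same)
      then have "p ^ s \<le> 1"
        using one gcd fin Max_ge by metis
      moreover have "1 < p ^ s"
        using \<open>prime p\<close> assms by (intro one_less_power) (auto simp: prime_gt_Suc_0_nat)
      ultimately show False by simp
    qed
  next
    assume none: "\<forall>p\<in>prime_factors k. \<not> p ^ s dvd m"
    have "d = 1" if d: "d ^ s dvd m" "d ^ s dvd k ^ s" for d
    proof (rule ccontr)
      assume "d \<noteq> 1"
      then obtain p where p: "prime p" "p dvd d"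
        using prime_factor_nat by blast
      have "d dvd k"
        using d assms by simp
      then have "p \<in> prime_factors k"
        using p assms by (auto simp: in_prime_factors_iff intro: dvd_trans)
      moreover have "p ^ s dvd m"
        using p d dvd_power_same dvd_trans by blast
      ultimately show False using none by blast
    qed
    then have "D = {1}"
      using \<open>1 \<in> D\<close> by (auto simp: D_def)
    then show "gen_gcd s m (k ^ s) = 1"
      by (simp add: gcd)
  qed
qed

lemma prod_power_dvd_iff:
  fixes A :: "nat set"
  assumes "finite A" "\<And>p. p \<in> A \<Longrightarrow> prime p"
  shows "(\<Prod>A) ^ s dvd m \<longleftrightarrow> (\<forall>p\<in>A. p ^ s dvd m)"
  using assms
proof (induction A rule: finite_induct)
  case (insert p A)
  have "coprime p (\<Prod>A)"
    using insert by (intro prod_coprime_right primes_coprime) auto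
  then have "coprime (p ^ s) ((\<Prod>A) ^ s)"
    by simp
  then have "p ^ s * (\<Prod>A) ^ s dvd m \<longleftrightarrow> p ^ s dvd m \<and> (\<Prod>A) ^ s dvd m"
    using divides_mult by (metis dvd_mult_left dvd_mult_right)
  then show ?case
    using insert by (simp add: power_mult_distrib)
qed simp

lemma prod_of_bool:
  assumes "finite A"
  shows "(\<Prod>x\<in>A. of_bool (Q x)) = (of_bool (\<forall>x\<in>A. Q x) :: 'a :: comm_semiring_1)"
  using assms by (induction A rule: finite_induct) auto

text \<open>Expand the product of \<open>1 - of_bool (p ^ s dvd m)\<close>. Powers of distinct
  primes are coprime, so the conditions over \<open>T\<close> merge into a single
  divisibility.\<close>

lemma inclusion_exclusion_prime_powers:
  fixes A :: "nat set"
  assumes "finite A" "\<And>p. p \<in> A \<Longrightarrow> prime p"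
  shows "(of_bool (\<forall>p\<in>A. \<not> p ^ s dvd m) :: complex)
    = (\<Sum>T\<in>Pow A. (-1) ^ card T * of_bool ((\<Prod>T) ^ s dvd m))"
proof -
  have "(of_bool (\<forall>p\<in>A. \<not> p ^ s dvd m) :: complex) = (\<Prod>p\<in>A. 1 - of_bool (p ^ s dvd m))"
    by (subst prod_of_bool[OF assms(1), symmetric]) (intro prod.cong; simp)
  also have "\<dots> = (\<Sum>T\<in>Pow A. (-1) ^ card T * (\<Prod>p\<in>T. of_bool (p ^ s dvd m)))"
    by (simp add: prod_diff_conv_sum[OF assms(1)])
  also have "\<dots> = (\<Sum>T\<in>Pow A. (-1) ^ card T * of_bool ((\<Prod>T) ^ s dvd m))"
  proof (intro sum.cong refl)
    fix T assume "T \<in> Pow A"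
    then have "finite T" "\<And>p. p \<in> T \<Longrightarrow> prime p"
      using assms finite_subset by auto
    then show "(-1) ^ card T * (\<Prod>p\<in>T. of_bool (p ^ s dvd m))
        = ((-1) ^ card T * of_bool ((\<Prod>T) ^ s dvd m) :: complex)"
      by (simp add: prod_of_bool prod_power_dvd_iff)
  qed
  finally show ?thesis .
qed

text \<open>The sum is geometric in an \<open>N\<close>-th root of unity \<open>w\<close>, and
  \<open>w = 1\<close> exactly when \<open>N\<close> divides \<open>j\<close>.\<close>

lemma sum_exp_additive_character:
  fixes N j :: nat
  assumes "N \<ge> 1"
  shows "(\<Sum>n = 1..N. exp (2 * of_real pi * \<i> * of_nat j * of_nat n / of_nat N))
    = (of_bool (N dvd j) * of_nat N :: complex)"
proof -
  define w :: complex where "w = exp (2 * of_real pi * \<i> * of_nat j / of_nat N)"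
  have pow: "exp (2 * of_real pi * \<i> * of_nat j * of_nat n / of_nat N) = w ^ n" for n
    unfolding w_def by (subst exp_of_nat_mult[symmetric]) (simp add: field_simps)
  have wN: "w ^ N = 1"
  proof -
    have "w ^ N = exp (2 * of_real pi * \<i>) ^ j"
      using assms unfolding w_def
      by (subst (1 2) exp_of_nat_mult[symmetric]) (simp add: field_simps)
    then show ?thesis by simp
  qed
  have shift: "(\<Sum>n = 1..N. w ^ n) = (\<Sum>n<N. w ^ n) * w"
    unfolding sum_distrib_right by (rule sum.reindex_bij_witness[of _ Suc "\<lambda>n. n - 1"])
      (auto simp flip: power_Suc2)
  have one_iff: "w = 1 \<longleftrightarrow> N dvd j"
  proof
    assume "w = 1"
    then obtain i :: int where "2 * pi * j / N = 2 * i * pi"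
      unfolding w_def exp_eq_1 by auto
    then have "real j = i * real N"
      using assms by (simp add: field_simps)
    then have "int j = i * int N"
      by (metis of_int_eq_iff of_int_mult of_int_of_nat_eq)
    then show "N dvd j"
      by (metis dvd_triv_right int_dvd_int_iff)
  next
    assume "N dvd j"
    then obtain i where "j = N * i" ..
    then have "w = exp (2 * of_real pi * \<i>) ^ i"
      using assms unfolding w_def by (subst exp_of_nat_mult[symmetric]) (simp add: field_simps)
    then show "w = 1" by simp
  qed
  show ?thesis
  proof (cases "w = 1")
    case True
    then show ?thesis using one_iff by (simp add: pow)
  next
    case False
    then show ?thesis
      unfolding pow shift using one_iff wN by (simp add: geometric_sum)
  qed
qed

lemma sum_multiples:
  fixes f :: "nat \<Rightarrow> 'a :: comm_monoid_add"
  assumes "d \<ge> 1"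
  shows "(\<Sum>m | m \<in> {1..d * n} \<and> d dvd m. f m) = (\<Sum>i = 1..n. f (d * i))"
  by (rule sum.reindex_bij_witness[of _ "\<lambda>i. d * i" "\<lambda>m. m div d"])
    (use assms in \<open>auto simp: Suc_le_eq elim!: dvdE\<close>)

lemma prod_subset_prime_factors_dvd:
  fixes k :: nat
  assumes "T \<subseteq> prime_factors k"
  shows "\<Prod>T dvd k"
proof -
  have "(\<Prod>T) ^ 1 dvd k"
    using assms finite_subset[OF assms]
    by (subst prod_power_dvd_iff) (auto simp: in_prime_factors_iff subset_iff)
  then show ?thesis by simp
qed

text \<open>After the sieve, the \<open>m\<close> belonging to \<open>T\<close> are the multiples of
  \<open>t ^ s\<close>, with \<open>t\<close> the product of \<open>T\<close>. Writing
  \<open>k = t * d\<close> turns them into a full period of a character modulo \<open>d ^ s\<close>,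
  whose sum is \<open>d ^ s\<close> or 0.\<close>

lemma cohen_ramanujan_sum_eq:
  assumes "s \<ge> 1" "k \<ge> 1"
  shows "cohen_ramanujan_sum s k (int j) = (\<Sum>T\<in>Pow (prime_factors k).
    (-1) ^ card T * (of_bool ((k div \<Prod>T) ^ s dvd j) * of_nat ((k div \<Prod>T) ^ s)))"
proof -
  define e :: "nat \<Rightarrow> complex"
    where "e m = exp (2 * of_real pi * \<i> * of_nat j * of_nat m / of_nat (k ^ s))" for m
  have inner: "(\<Sum>m = 1..k ^ s. of_bool ((\<Prod>T) ^ s dvd m) * e m)
      = of_bool ((k div \<Prod>T) ^ s dvd j) * of_nat ((k div \<Prod>T) ^ s)"
    if "T \<subseteq> prime_factors k" for T
  proof -
    obtain d where k: "k = \<Prod>T * d"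
      using prod_subset_prime_factors_dvd[OF \<open>T \<subseteq> prime_factors k\<close>] ..
    have "\<Prod>T * d \<noteq> 0"
      using assms k by linarith
    then have pos: "\<Prod>T \<ge> 1" "d \<ge> 1"
      unfolding mult_eq_0_iff by linarith+
    have "(\<Sum>m = 1..k ^ s. of_bool ((\<Prod>T) ^ s dvd m) * e m)
        = (\<Sum>m | m \<in> {1..(\<Prod>T) ^ s * d ^ s} \<and> (\<Prod>T) ^ s dvd m. e m)"
      by (rule sum.mono_neutral_cong_right) (auto simp: k power_mult_distrib)
    also have "\<dots> = (\<Sum>n = 1..d ^ s. e ((\<Prod>T) ^ s * n))"
      by (rule sum_multiples) (use pos in simp)
    also have "\<dots> = (\<Sum>n = 1..d ^ s. exp (2 * of_real pi * \<i> * of_nat j * of_nat n / of_nat (d ^ s)))"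
      using pos by (intro sum.cong refl) (simp add: e_def k power_mult_distrib mult.assoc del: of_nat_prod)
    also have "\<dots> = of_bool (d ^ s dvd j) * of_nat (d ^ s)"
      by (rule sum_exp_additive_character) (use pos in simp)
    also have "d = k div \<Prod>T"
      using pos k by simp
    finally show ?thesis .
  qed
  have sieve: "(of_bool (\<forall>p\<in>prime_factors k. \<not> p ^ s dvd m) :: complex)
      = (\<Sum>T\<in>Pow (prime_factors k). (-1) ^ card T * of_bool ((\<Prod>T) ^ s dvd m))" for m
    by (rule inclusion_exclusion_prime_powers) auto
  have "cohen_ramanujan_sum s k (int j)
      = (\<Sum>m = 1..k ^ s. of_bool (\<forall>p\<in>prime_factors k. \<not> p ^ s dvd m) * e m)"
    unfolding cohen_ramanujan_sum_def e_def
    by (rule sum.mono_neutral_cong_left) (use gen_gcd_power_eq_1_iff[OF assms] in auto)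
  also have "\<dots> = (\<Sum>m = 1..k ^ s. \<Sum>T\<in>Pow (prime_factors k).
      (-1) ^ card T * (of_bool ((\<Prod>T) ^ s dvd m) * e m))"
    by (simp only: sieve sum_distrib_right mult.assoc)
  also have "\<dots> = (\<Sum>T\<in>Pow (prime_factors k). (-1) ^ card T *
      (\<Sum>m = 1..k ^ s. of_bool ((\<Prod>T) ^ s dvd m) * e m))"
    unfolding sum_distrib_left by (rule sum.swap)
  also have "\<dots> = (\<Sum>T\<in>Pow (prime_factors k). (-1) ^ card T *
      (of_bool ((k div \<Prod>T) ^ s dvd j) * of_nat ((k div \<Prod>T) ^ s)))"
    by (intro sum.cong refl) (simp only: inner Pow_iff)
  finally show ?thesis .
qed

text \<open>The right Riemann sum of \<open>x ^ r\<close> on the unit interval with \<open>N\<close>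
  equal steps, hence close to \<open>1 / (r + 1)\<close>.\<close>

definition power_mean :: "nat \<Rightarrow> nat \<Rightarrow> real" where
  "power_mean r N = (\<Sum>i = 1..N. real i ^ r) / real N ^ (r + 1)"

text \<open>With \<open>k = t * d\<close> as before, only \<open>j = d ^ s * i\<close> with
  \<open>i \<le> t ^ s\<close> survive in the term of \<open>T\<close>. The power
  \<open>j ^ r\<close> and the weight \<open>d ^ s\<close> give \<open>d ^ (s * (r + 1))\<close>;
  the matching power of \<open>t\<close> comes from the denominator of
  \<open>power_mean\<close>.\<close>

lemma cohen_ramanujan_moment:
  assumes "s \<ge> 1" "k \<ge> 1"
  shows "1 / of_nat (k ^ (s * (r + 1))) *
      (\<Sum>j = 1..k ^ s. of_nat j ^ r * cohen_ramanujan_sum s k (int j))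
    = of_real (\<Sum>T\<in>Pow (prime_factors k). (-1) ^ card T * power_mean r ((\<Prod>T) ^ s))"
proof -
  have inner: "(\<Sum>j = 1..k ^ s. of_nat j ^ r *
        (of_bool ((k div \<Prod>T) ^ s dvd j) * of_nat ((k div \<Prod>T) ^ s)))
      = (of_nat (k ^ (s * (r + 1))) * of_real (power_mean r ((\<Prod>T) ^ s)) :: complex)"
    if "T \<subseteq> prime_factors k" for T
  proof -
    obtain d where k: "k = \<Prod>T * d"
      using prod_subset_prime_factors_dvd[OF \<open>T \<subseteq> prime_factors k\<close>] ..
    define t where "t = \<Prod>T"
    have kt: "k = t * d" using k by (simp add: t_def)
    have "t * d \<noteq> 0"
      using assms kt by linarith
    then have pos: "t \<ge> 1" "d \<ge> 1"
      unfolding mult_eq_0_iff by linarith+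
    have "k div \<Prod>T = d"
      using pos kt by (simp add: t_def)
    then have "(\<Sum>j = 1..k ^ s. of_nat j ^ r *
          (of_bool ((k div \<Prod>T) ^ s dvd j) * of_nat ((k div \<Prod>T) ^ s)))
        = (\<Sum>j | j \<in> {1..d ^ s * t ^ s} \<and> d ^ s dvd j. of_nat j ^ r * of_nat (d ^ s) :: complex)"
      by (intro sum.mono_neutral_cong_right) (auto simp: kt power_mult_distrib mult.commute)
    also have "\<dots> = (\<Sum>i = 1..t ^ s. of_nat (d ^ s * i) ^ r * of_nat (d ^ s))"
      by (rule sum_multiples) (use pos in simp)
    also have "\<dots> = of_nat (d ^ s) ^ (r + 1) * (\<Sum>i = 1..t ^ s. of_nat i ^ r)"
      by (simp add: sum_distrib_left power_mult_distrib mult_ac)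
    also have "\<dots> = of_nat (k ^ (s * (r + 1))) * of_real (power_mean r (t ^ s))"
      using pos by (simp add: power_mean_def kt power_mult_distrib power_mult power_add)
    finally show ?thesis by (simp add: t_def)
  qed
  have "(\<Sum>j = 1..k ^ s. of_nat j ^ r * cohen_ramanujan_sum s k (int j))
      = (\<Sum>T\<in>Pow (prime_factors k). (-1) ^ card T * (\<Sum>j = 1..k ^ s. of_nat j ^ r *
          (of_bool ((k div \<Prod>T) ^ s dvd j) * of_nat ((k div \<Prod>T) ^ s))))"
    unfolding cohen_ramanujan_sum_eq[OF assms] sum_distrib_left
    by (subst sum.swap) (simp add: mult_ac)
  also have "\<dots> = (\<Sum>T\<in>Pow (prime_factors k). (-1) ^ card T *
      (of_nat (k ^ (s * (r + 1))) * of_real (power_mean r ((\<Prod>T) ^ s))))"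
    by (intro sum.cong refl) (simp only: inner Pow_iff)
  also have "\<dots> = of_nat (k ^ (s * (r + 1))) *
      of_real (\<Sum>T\<in>Pow (prime_factors k). (-1) ^ card T * power_mean r ((\<Prod>T) ^ s))"
    by (simp add: sum_distrib_left mult_ac)
  finally show ?thesis
    using assms by simp
qed

section \<open>Power means and the comparison with the Jordan totient\<close>

lemma Suc_power_Suc_bounds:
  fixes x :: real
  assumes "x \<ge> 0"
  shows "(x + 1) ^ Suc r - x ^ Suc r \<le> (real r + 1) * (x + 1) ^ r"
    and "(real r + 1) * x ^ r \<le> (x + 1) ^ Suc r - x ^ Suc r"
proof -
  \<comment> \<open>A discrete mean value theorem: each of the \<open>r + 1\<close> summands lies
    between \<open>x ^ r\<close> and \<open>(x + 1) ^ r\<close>.\<close>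
  have eq: "(x + 1) ^ Suc r - x ^ Suc r = (\<Sum>p<Suc r. (x + 1) ^ p * x ^ (r - p))"
    by (simp only: diff_power_eq_sum) simp
  have "(\<Sum>p<Suc r. (x + 1) ^ p * x ^ (r - p)) \<le> (\<Sum>p<Suc r. (x + 1) ^ r)"
  proof (rule sum_mono)
    fix p assume "p \<in> {..<Suc r}"
    then have "(x + 1) ^ r = (x + 1) ^ p * (x + 1) ^ (r - p)"
      by (simp flip: power_add)
    then show "(x + 1) ^ p * x ^ (r - p) \<le> (x + 1) ^ r"
      using assms by (auto intro!: mult_left_mono power_mono)
  qed
  then show "(x + 1) ^ Suc r - x ^ Suc r \<le> (real r + 1) * (x + 1) ^ r"
    by (simp only: eq) (simp add: algebra_simps)
  have "(\<Sum>p<Suc r. x ^ r) \<le> (\<Sum>p<Suc r. (x + 1) ^ p * x ^ (r - p))"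
  proof (rule sum_mono)
    fix p assume "p \<in> {..<Suc r}"
    then have "x ^ r = x ^ p * x ^ (r - p)"
      by (simp flip: power_add)
    then show "x ^ r \<le> (x + 1) ^ p * x ^ (r - p)"
      using assms by (auto intro!: mult_right_mono power_mono)
  qed
  then show "(real r + 1) * x ^ r \<le> (x + 1) ^ Suc r - x ^ Suc r"
    by (simp only: eq) (simp add: algebra_simps)
qed

text \<open>Both inductions telescope the preceding bounds. The excess
  \<open>(r + 1) * n ^ r\<close> in the upper one accounts for the last summand and becomes
  \<open>1 / N\<close> after normalisation.\<close>

lemma power_mean_bounds:
  assumes "N \<ge> 1"
  shows "1 / (real r + 1) \<le> power_mean r N" "power_mean r N \<le> 1 / (real r + 1) + 1 / real N"
proof -
  have lower: "real n ^ Suc r \<le> (real r + 1) * (\<Sum>i = 1..n. real i ^ r)" for n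
  proof (induction n)
    case (Suc n)
    then show ?case
      using Suc_power_Suc_bounds(1)[of "real n" r] by (simp add: algebra_simps)
  qed simp
  have upper: "(real r + 1) * (\<Sum>i = 1..n. real i ^ r) \<le> real n ^ Suc r + (real r + 1) * real n ^ r" for n
  proof (induction n)
    case (Suc n)
    then show ?case
      using Suc_power_Suc_bounds(2)[of "real n" r] by (simp add: algebra_simps)
  qed simp
  show "1 / (real r + 1) \<le> power_mean r N"
    using lower[of N] assms by (simp add: power_mean_def field_simps)
  have "power_mean r N = (real r + 1) * (\<Sum>i = 1..N. real i ^ r) / ((real r + 1) * real N ^ (r + 1))"
    by (simp add: power_mean_def)
  also have "\<dots> \<le> (real N ^ Suc r + (real r + 1) * real N ^ r) / ((real r + 1) * real N ^ (r + 1))"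
    by (rule divide_right_mono[OF upper]) simp
  also have "\<dots> = 1 / (real r + 1) + 1 / real N"
    using assms by (simp add: add_divide_distrib)
  finally show "power_mean r N \<le> 1 / (real r + 1) + 1 / real N" .
qed

text \<open>Expanding the Euler product gives a sum over the same subsets as the moment, so the two
  can be compared term by term.\<close>

lemma jordan_totient_normalized:
  assumes "k \<ge> 1"
  shows "jordan_totient s k / real k ^ s
    = (\<Sum>T\<in>Pow (prime_factors k). (-1) ^ card T * (1 / real ((\<Prod>T) ^ s)))"
proof -
  have "{p. prime p \<and> p dvd k} = prime_factors k"
    using assms by (auto simp: in_prime_factors_iff)
  then have "jordan_totient s k / real k ^ s = (\<Prod>p\<in>prime_factors k. 1 - 1 / real p ^ s)"
    using assms by (simp add: jordan_totient_def)
  also have "\<dots> = (\<Sum>T\<in>Pow (prime_factors k). (-1) ^ card T * (1 / real ((\<Prod>T) ^ s)))"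
    by (simp add: prod_diff_conv_sum prod_dividef prod_power_distrib)
  finally show ?thesis .
qed

lemma cohen_ramanujan_moment_approx:
  assumes "s \<ge> 1" "k \<ge> 2"
  shows "norm (1 / of_nat (k ^ (s * (r + 1))) *
        (\<Sum>j = 1..k ^ s. of_nat j ^ r * cohen_ramanujan_sum s k (int j))
      - of_real (jordan_totient s k / real k ^ s - 1 / (real r + 1)))
    \<le> exp (\<Sum>p\<in>prime_factors k. 1 / real p) - 1"
proof -
  define F where "F = prime_factors k"
  have fin: "finite F" by (simp add: F_def)
  have "k \<ge> 1" using assms by simp
  obtain q where "prime q" "q dvd k"
    using assms prime_factor_nat[of k] by auto
  then have "F \<noteq> {}"
    using assms by (auto simp: F_def prime_factors_dvd)
  have pos: "\<Prod>T \<ge> 1" if "T \<subseteq> F" for T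
  proof -
    have "0 < \<Prod>T"
      using that by (intro prod_pos) (auto simp: F_def in_prime_factors_iff intro: prime_gt_0_nat)
    then show ?thesis by simp
  qed
  \<comment> \<open>For \<open>T \<subseteq> F\<close>, \<open>power_mean_bounds\<close> puts
    \<open>g T\<close> between \<open>- 1 / n\<close> and 0, where \<open>n\<close> is the
    \<open>s\<close>-th power of the product of \<open>T\<close>.\<close>
  define g where "g T = power_mean r ((\<Prod>T) ^ s) - 1 / real ((\<Prod>T) ^ s) - 1 / (real r + 1)" for T :: "nat set"
  \<comment> \<open>As \<open>k \<ge> 2\<close> makes \<open>F\<close> nonempty, the constants
    \<open>1 / (r + 1)\<close> cancel in the alternating sum.\<close>
  have "(\<Sum>T\<in>Pow F. (-1) ^ card T) = (\<Prod>p\<in>F. 1 - 1 :: real)"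
    by (simp only: prod_diff_conv_sum[OF fin] prod.neutral_const mult_1_right)
  also have "\<dots> = 0"
    using fin \<open>F \<noteq> {}\<close> by (simp add: card_gt_0_iff)
  finally have alt: "(\<Sum>T\<in>Pow F. (-1) ^ card T) = (0 :: real)" .
  \<comment> \<open>The empty set has mean 1, so its term cancels the isolated
    \<open>1 / (r + 1)\<close> and only nonempty \<open>T\<close> remain.\<close>
  have g0: "g {} = - (1 / (real r + 1))"
    by (simp add: g_def power_mean_def)
  have g_bound: "\<bar>g T\<bar> \<le> (\<Prod>p\<in>T. 1 / real p)" if "T \<subseteq> F" for T
  proof -
    have "(\<Prod>T) ^ s \<ge> 1" using pos[OF that] by simp
    note power_mean_bounds[OF this, of r]
    then have "\<bar>g T\<bar> \<le> 1 / real ((\<Prod>T) ^ s)"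
      by (simp add: g_def)
    \<comment> \<open>Since \<open>s \<ge> 1\<close>, dropping the exponent weakens the bound and
      makes it uniform in \<open>s\<close>.\<close>
    also have "\<dots> \<le> 1 / real (\<Prod>T)"
      using pos[OF that] assms self_le_power[of "\<Prod>T" s]
      by (intro divide_left_mono) (auto simp del: of_nat_prod of_nat_power)
    finally show ?thesis
      by (simp add: prod_dividef)
  qed
  have "(\<Sum>T\<in>Pow F. (-1) ^ card T * power_mean r ((\<Prod>T) ^ s))
      - (jordan_totient s k / real k ^ s - 1 / (real r + 1))
      = (\<Sum>T\<in>Pow F. (-1) ^ card T * g T) + (\<Sum>T\<in>Pow F. (-1) ^ card T) * (1 / (real r + 1))
        + 1 / (real r + 1)"
    unfolding jordan_totient_normalized[OF \<open>k \<ge> 1\<close>] g_def F_def[symmetric] sum_distrib_right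
    by (simp add: algebra_simps sum.distrib sum_subtractf)
  also have "\<dots> = (\<Sum>T\<in>Pow F - {{}}. (-1) ^ card T * g T)"
    using fin by (simp add: alt sum_diff1 g0)
  finally have eq: "(\<Sum>T\<in>Pow F. (-1) ^ card T * power_mean r ((\<Prod>T) ^ s))
      - (jordan_totient s k / real k ^ s - 1 / (real r + 1))
      = (\<Sum>T\<in>Pow F - {{}}. (-1) ^ card T * g T)" .
  have "norm (1 / of_nat (k ^ (s * (r + 1))) *
        (\<Sum>j = 1..k ^ s. of_nat j ^ r * cohen_ramanujan_sum s k (int j))
      - of_real (jordan_totient s k / real k ^ s - 1 / (real r + 1)))
      = \<bar>\<Sum>T\<in>Pow F - {{}}. (-1) ^ card T * g T\<bar>"
    unfolding cohen_ramanujan_moment[OF \<open>s \<ge> 1\<close> \<open>k \<ge> 1\<close>] F_def[symmetric]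
      of_real_diff[symmetric] norm_of_real eq ..
  also have "\<dots> \<le> (\<Sum>T\<in>Pow F - {{}}. \<bar>(-1) ^ card T * g T\<bar>)"
    by (rule sum_abs)
  also have "\<dots> \<le> (\<Sum>T\<in>Pow F - {{}}. \<Prod>p\<in>T. 1 / real p)"
    using g_bound by (intro sum_mono) (auto simp: abs_mult power_abs)
  also have "\<dots> = (\<Prod>p\<in>F. 1 / real p + 1) - 1"
    using fin by (simp add: prod_add sum_diff1)
  also have "(\<Prod>p\<in>F. 1 / real p + 1) \<le> (\<Prod>p\<in>F. exp (1 / real p))"
    by (intro prod_mono) (auto simp: add.commute)
  also have "\<dots> = exp (\<Sum>p\<in>F. 1 / real p)"
    by (rule exp_sum[OF fin, symmetric])
  finally show ?thesis by (simp add: F_def)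
qed

subsection \<open>Densities of sieved sets\<close>

text \<open>A description by prime divisors is easy to use with products and divisors. For nonempty
  \<open>P\<close>, membership in the original set follows by peeling off one prime at a
  time.\<close>

lemma beurling_integers_eq:
  assumes "\<forall>p\<in>P. prime p"
  shows "beurling_integers P = {n. 0 < n \<and> (\<forall>p. prime p \<longrightarrow> p dvd n \<longrightarrow> p \<in> P)}" (is "_ = ?R")
proof (cases "P = {}")
  case True
  have "n = 1" if "n \<in> ?R" for n
    using that True prime_factor_nat by fastforce
  then show ?thesis
    using True by (auto simp: beurling_integers_def)
next
  case False
  define S where "S = {\<Prod>j = 1..t. p j ^ a j | (t::nat) p (a :: nat \<Rightarrow> nat).
              t \<ge> 1 \<and> (\<forall>j \<in> {1..t}. p j \<in> P)}"
  have S: "beurling_integers P = S"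
    using False by (simp add: beurling_integers_def S_def)
  have "S \<subseteq> ?R"
  proof
    fix n assume "n \<in> S"
    then obtain t p and a :: "nat \<Rightarrow> nat"
      where n: "n = (\<Prod>j = 1..t. p j ^ a j)" and p: "\<forall>j\<in>{1..t}. p j \<in> P"
      by (auto simp: S_def)
    have "0 < n"
      unfolding n using p assms by (intro prod_pos) (auto intro: prime_gt_0_nat)
    moreover have "q \<in> P" if q: "prime q" "q dvd n" for q
    proof -
      obtain j where j: "j \<in> {1..t}" "q dvd p j ^ a j"
        using q unfolding n by (auto simp: prime_dvd_prod_iff)
      then have "q dvd p j"
        using q prime_dvd_power by blast
      then have "q = p j"
        using p j q assms primes_dvd_imp_eq by blast
      then show ?thesis using p j by simp
    qed
    ultimately show "n \<in> ?R" by blast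
  qed
  moreover have "n \<in> S" if "n \<in> ?R" for n
    using that
  proof (induction n rule: less_induct)
    case (less n)
    show ?case
    proof (cases "n = 1")
      case True
      \<comment> \<open>The definition demands \<open>t \<ge> 1\<close>, so 1 is written as
        \<open>q ^ 0\<close>.\<close>
      obtain q where "q \<in> P" using False by blast
      then show ?thesis
        unfolding S_def True mem_Collect_eq
        by (intro exI[of _ 1] exI[of _ "\<lambda>_. q"] exI[of _ "\<lambda>_. 0"]) auto
    next
      case False
      then obtain q where q: "prime q" "q dvd n"
        using prime_factor_nat by blast
      then obtain m where m: "n = q * m" by blast
      have "m \<in> ?R" "m < n"
        using less.prems m q prime_gt_1_nat[of q] by auto
      then have "m \<in> S" using less.IH by blast
      then obtain t p and a :: "nat \<Rightarrow> nat"
        where mS: "m = (\<Prod>j = 1..t. p j ^ a j)" and p: "\<forall>j\<in>{1..t}. p j \<in> P"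
        by (auto simp: S_def)
      have "q \<in> P" using less.prems q by blast
      have "n = (\<Prod>j = 1..Suc t. (p(Suc t := q)) j ^ (a(Suc t := 1)) j)"
        unfolding m mS prod.cl_ivl_Suc by (simp add: mult.commute)
      then show ?thesis
        unfolding S_def mem_Collect_eq using p \<open>q \<in> P\<close>
        by (intro exI[of _ "Suc t"] exI[of _ "p(Suc t := q)"] exI[of _ "a(Suc t := 1)"]) auto
    qed
  qed
  ultimately show ?thesis unfolding S by blast
qed

text \<open>The sieve below needs both directions: closure under products and under
  divisors.\<close>

lemma beurling_integers_mult_iff:
  assumes "\<forall>p\<in>P. prime p"
  shows "a * b \<in> beurling_integers P \<longleftrightarrow> a \<in> beurling_integers P \<and> b \<in> beurling_integers P"
  by (auto simp: beurling_integers_eq[OF assms] prime_dvd_mult_iff)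

text \<open>The simplifier turns \<open>1\<close> into \<open>Suc 0\<close>, so the rule is stored
  in that form in order to match.\<close>

lemma finite_counting_set [unfolded One_nat_def, simp]: "finite {a \<in> A. 1 \<le> a \<and> real a \<le> x}"
  by (rule finite_subset[of _ "{..nat \<lfloor>x\<rfloor>}"]) (auto simp: le_nat_floor)

lemma counting_fun_mono:
  "A \<subseteq> B \<Longrightarrow> counting_fun A x \<le> counting_fun B x"
  unfolding counting_fun_def by (intro of_nat_mono card_mono) auto

lemma counting_fun_Diff:
  assumes "B \<subseteq> A"
  shows "counting_fun (A - B) x = counting_fun A x - counting_fun B x"
proof -
  have "{a \<in> A - B. 1 \<le> a \<and> real a \<le> x}
      = {a \<in> A. 1 \<le> a \<and> real a \<le> x} - {a \<in> B. 1 \<le> a \<and> real a \<le> x}"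
    by auto
  moreover have "{a \<in> B. 1 \<le> a \<and> real a \<le> x} \<subseteq> {a \<in> A. 1 \<le> a \<and> real a \<le> x}"
    using assms by auto
  ultimately show ?thesis
    by (simp add: counting_fun_def card_Diff_subset card_mono of_nat_diff)
qed

lemma counting_fun_dilate:
  assumes "q > 0"
  shows "counting_fun ((*) q ` A) x = counting_fun A (x / real q)"
proof -
  have "{a \<in> (*) q ` A. 1 \<le> a \<and> real a \<le> x} = (*) q ` {a \<in> A. 1 \<le> a \<and> real a \<le> x / real q}"
    using assms by (auto simp: field_simps Suc_le_eq)
  moreover have "inj_on ((*) q) X" for X
    using assms by (simp add: inj_on_def)
  ultimately show ?thesis
    by (simp add: counting_fun_def card_image)
qed

lemma counting_fun_le:
  assumes "x \<ge> 0"
  shows "counting_fun A x \<le> x"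
proof -
  have "{a \<in> A. 1 \<le> a \<and> real a \<le> x} \<subseteq> {1..nat \<lfloor>x\<rfloor>}"
    by (auto simp: le_nat_floor)
  then have "card {a \<in> A. 1 \<le> a \<and> real a \<le> x} \<le> card {1..nat \<lfloor>x\<rfloor>}"
    by (intro card_mono) auto
  then have "counting_fun A x \<le> real (nat \<lfloor>x\<rfloor>)"
    by (simp add: counting_fun_def)
  then show ?thesis using assms by linarith
qed

lemma counting_fun_multiples_le:
  assumes "x \<ge> 0" "q > 0"
  shows "counting_fun {k. q dvd k} x \<le> x / real q"
proof -
  have "{k. q dvd k} = (*) q ` UNIV"
    by (auto elim: dvdE)
  then show ?thesis
    using counting_fun_dilate[of q UNIV x] counting_fun_le[of "x / real q" UNIV] assms by simp
qed

lemma counting_fun_UN_le: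
  assumes "finite I"
  shows "counting_fun (\<Union>i\<in>I. A i) x \<le> (\<Sum>i\<in>I. counting_fun (A i) x)"
proof -
  have "{a \<in> \<Union>i\<in>I. A i. 1 \<le> a \<and> real a \<le> x} = (\<Union>i\<in>I. {a \<in> A i. 1 \<le> a \<and> real a \<le> x})"
    by auto
  then show ?thesis
    using of_nat_mono[OF card_UN_le[OF assms, of "\<lambda>i. {a \<in> A i. 1 \<le> a \<and> real a \<le> x}"]]
    by (simp add: counting_fun_def)
qed

lemma has_asymptotic_density_Diff:
  assumes "has_asymptotic_density A \<alpha>" "has_asymptotic_density B \<beta>" "B \<subseteq> A"
  shows "has_asymptotic_density (A - B) (\<alpha> - \<beta>)"
  using tendsto_diff[OF assms(1,2)[unfolded has_asymptotic_density_def]]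
  by (simp add: has_asymptotic_density_def counting_fun_Diff[OF assms(3)] diff_divide_distrib)

lemma has_asymptotic_density_dilate:
  assumes "has_asymptotic_density A \<alpha>" "q > 0"
  shows "has_asymptotic_density ((*) q ` A) (\<alpha> / real q)"
proof -
  have "filterlim (\<lambda>x. x / real q) at_top at_top"
    using assms(2) filterlim_tendsto_pos_mult_at_top[OF tendsto_const[of "1 / real q"] _ filterlim_ident]
    by simp
  then have "((\<lambda>x. counting_fun A (x / real q) / (x / real q)) \<longlongrightarrow> \<alpha>) at_top"
    by (rule filterlim_compose[OF assms(1)[unfolded has_asymptotic_density_def]])
  then have "((\<lambda>x. counting_fun A (x / real q) / (x / real q) / real q) \<longlongrightarrow> \<alpha> / real q) at_top"
    using assms(2) by (intro tendsto_divide tendsto_const) auto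
  then have "((\<lambda>x. counting_fun A (x / real q) / x) \<longlongrightarrow> \<alpha> / real q) at_top"
    using assms(2) by simp
  then show ?thesis
    by (simp only: has_asymptotic_density_def counting_fun_dilate[OF assms(2)])
qed

lemma has_asymptotic_density_empty: "has_asymptotic_density {} 0"
  by (simp add: has_asymptotic_density_def counting_fun_def)

section \<open>Sieving by finitely and by infinitely many divisors\<close>

definition free_of :: "nat set \<Rightarrow> nat set \<Rightarrow> nat set" where
  "free_of Q B = {k \<in> B. \<forall>q\<in>Q. \<not> q dvd k}"

text \<open>Cancelling the gcd leaves a cofactor of \<open>q\<close> coprime to that of
  \<open>a\<close>.\<close>

lemma dvd_mult_iff_div_gcd:
  fixes q a m :: nat
  assumes "a > 0"
  shows "q dvd a * m \<longleftrightarrow> q div gcd q a dvd m"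
proof -
  define g where "g = gcd q a"
  obtain q' a' where q': "q = g * q'" and a': "a = g * a'"
    unfolding g_def by (meson dvdE gcd_dvd1 gcd_dvd2)
  have "g > 0" using assms by (simp add: g_def)
  have "coprime q' a'"
    using div_gcd_coprime[of q a] assms \<open>g > 0\<close> by (simp add: g_def[symmetric]) (simp add: q' a')
  then have "q dvd a * m \<longleftrightarrow> q' dvd m"
    using \<open>g > 0\<close> by (simp add: q' a' mult.assoc coprime_dvd_mult_right_iff)
  then show ?thesis
    using \<open>g > 0\<close> by (simp add: g_def[symmetric]) (simp add: q')
qed

text \<open>
  The members of \<open>free_of Q' B\<close> divisible by \<open>q\<close> are \<open>q\<close> times the members of \<open>B\<close> free of the
  numbers \<open>r div gcd r q\<close> for \<open>r \<in> Q'\<close>, so sieving by one more divisor reduces to smaller sieves.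
\<close>

lemma density_free_of_finite:
  assumes dens: "has_asymptotic_density B c"
    and mult: "\<And>a b. a * b \<in> B \<longleftrightarrow> a \<in> B \<and> b \<in> B" and "0 \<notin> B"
    and "finite Q"
  shows "\<exists>d. has_asymptotic_density (free_of Q B) d"
  using \<open>finite Q\<close>
\<comment> \<open>Induction on the cardinality, because the set \<open>Q''\<close> below is an image
  of \<open>Q'\<close> and need not be a subset of \<open>Q\<close>.\<close>
proof (induction "card Q" arbitrary: Q rule: less_induct)
  case less
  show ?case
  proof (cases "Q = {}")
    case True
    then show ?thesis using dens by (auto simp: free_of_def)
  next
    case False
    then obtain q where "q \<in> Q" by blast
    define Q' where "Q' = Q - {q}"
    have Q': "Q = insert q Q'" "finite Q'" "card Q' < card Q"
      using \<open>q \<in> Q\<close> less.prems card_Diff1_less[of Q q] by (auto simp: Q'_def)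
    obtain d where d: "has_asymptotic_density (free_of Q' B) d"
      using less.hyps Q' by blast
    define M where "M = {k \<in> free_of Q' B. q dvd k}"
    have "free_of Q B = free_of Q' B - M"
      by (auto simp: M_def free_of_def Q')
    moreover have "\<exists>e. has_asymptotic_density M e"
    proof (cases "q \<in> B")
      case True
      then have "q > 0" using \<open>0 \<notin> B\<close> by (metis gr0I)
      define Q'' where "Q'' = (\<lambda>r. r div gcd r q) ` Q'"
      have "finite Q''" "card Q'' < card Q"
        using Q' card_image_le[of Q' "\<lambda>r. r div gcd r q"] by (auto simp: Q''_def)
      then obtain e where "has_asymptotic_density (free_of Q'' B) e"
        using less.hyps by blast
      moreover have "M = (*) q ` free_of Q'' B"
      proof (intro set_eqI iffI)
        fix k assume "k \<in> M"
        then obtain m where m: "k = q * m" "q * m \<in> B" "\<forall>r\<in>Q'. \<not> r dvd q * m"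
          by (auto simp: M_def free_of_def elim!: dvdE)
        then have "m \<in> free_of Q'' B"
          using mult \<open>q > 0\<close> by (auto simp: free_of_def Q''_def dvd_mult_iff_div_gcd)
        then show "k \<in> (*) q ` free_of Q'' B" using m by blast
      next
        fix k assume "k \<in> (*) q ` free_of Q'' B"
        then show "k \<in> M"
          using mult \<open>q > 0\<close> \<open>q \<in> B\<close> by (auto simp: M_def free_of_def Q''_def dvd_mult_iff_div_gcd)
      qed
      ultimately show ?thesis
        using has_asymptotic_density_dilate \<open>q > 0\<close> by metis
    next
      case False
      have "k \<notin> M" for k
        using False mult by (auto simp: M_def free_of_def elim!: dvdE)
      then have "M = {}" by blast
      then show ?thesis using has_asymptotic_density_empty by auto
    qed
    moreover have "M \<subseteq> free_of Q' B" by (auto simp: M_def)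
    ultimately show ?thesis
      using d has_asymptotic_density_Diff by metis
  qed
qed

text \<open>The counting ratio of \<open>B\<close> is trapped between those of \<open>A z\<close>
  lowered by \<open>e z\<close> and of \<open>A z\<close>. Hence the densities \<open>d z\<close>
  form a Cauchy sequence, and its limit is the density of \<open>B\<close>.\<close>

lemma density_approximation:
  assumes dens: "\<And>z. has_asymptotic_density (A z) (d z)"
    and sub: "\<And>z. B \<subseteq> A z"
    and diff: "\<And>z x. x > 0 \<Longrightarrow> counting_fun (A z) x - counting_fun B x \<le> e z * x"
    and e: "e \<longlonglongrightarrow> 0"
  shows "\<exists>\<delta>. has_asymptotic_density B \<delta> \<and> (\<forall>z. d z - e z \<le> \<delta>)"
proof -
  define f where "f A x = counting_fun A x / x" for A x
  have lim: "(f (A z) \<longlongrightarrow> d z) at_top" for z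
    using dens by (simp add: has_asymptotic_density_def f_def[abs_def])
  have upper: "f B x \<le> f (A z) x" if "x > 0" for z x
    using that counting_fun_mono[OF sub] by (simp add: f_def divide_right_mono)
  have lower: "f (A z) x - e z \<le> f B x" if "x > 0" for z x
  proof -
    have "f (A z) x \<le> (counting_fun B x + e z * x) / x"
      unfolding f_def using that diff[OF that, of z] by (intro divide_right_mono) auto
    also have "\<dots> = f B x + e z"
      using that by (simp add: f_def add_divide_distrib)
    finally show ?thesis by simp
  qed
  \<comment> \<open>Any two indices are compared through \<open>B\<close>, which lies in
    \<open>A w\<close> and is at most \<open>e z\<close> thinner than \<open>A z\<close>.\<close>
  have compare: "d z - e z \<le> d w" for z w
  proof (rule tendsto_le[OF _ lim tendsto_diff[OF lim tendsto_const]])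
    show "\<forall>\<^sub>F x in at_top. f (A z) x - e z \<le> f (A w) x"
      using eventually_gt_at_top[of 0] by eventually_elim (use lower upper order_trans in blast)
  qed simp
  have "Cauchy d"
  proof (rule metric_CauchyI)
    fix r :: real assume "0 < r"
    then have "\<forall>\<^sub>F n in sequentially. e n < r"
      using order_tendstoD(2)[OF e] by blast
    then obtain M where M: "\<And>n. n \<ge> M \<Longrightarrow> e n < r"
      by (auto simp: eventually_sequentially)
    have "dist (d m) (d n) < r" if "m \<ge> M" "n \<ge> M" for m n
      using compare[of m n] compare[of n m] M[OF that(1)] M[OF that(2)] by (simp add: dist_real_def)
    then show "\<exists>M. \<forall>m\<ge>M. \<forall>n\<ge>M. dist (d m) (d n) < r" by blast
  qed
  then obtain \<delta> where \<delta>: "d \<longlonglongrightarrow> \<delta>"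
    using Cauchy_convergent convergentD by blast
  have "(f B \<longlongrightarrow> \<delta>) at_top"
  proof (rule order_tendstoI)
    fix a assume "a < \<delta>"
    have "(\<lambda>z. d z - e z) \<longlonglongrightarrow> \<delta>"
      using tendsto_diff[OF \<delta> e] by simp
    then obtain z where "a < d z - e z"
      using order_tendstoD(1)[OF _ \<open>a < \<delta>\<close>] eventually_sequentially by (metis le_refl)
    then have "\<forall>\<^sub>F x in at_top. a + e z < f (A z) x"
      by (intro order_tendstoD(1)[OF lim]) simp
    then show "\<forall>\<^sub>F x in at_top. a < f B x"
      using eventually_gt_at_top[of 0] by eventually_elim (use lower[of _ z] in force)
  next
    fix a assume "\<delta> < a"
    then obtain z where "d z < a"
      using order_tendstoD(2)[OF \<delta>] eventually_sequentially by (metis le_refl)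
    then have "\<forall>\<^sub>F x in at_top. f (A z) x < a"
      by (rule order_tendstoD(2)[OF lim])
    then show "\<forall>\<^sub>F x in at_top. f B x < a"
      using eventually_gt_at_top[of 0] by eventually_elim (use upper[of _ z] in force)
  qed
  moreover have "d z - e z \<le> \<delta>" for z
    by (rule LIMSEQ_le_const[OF \<delta>]) (use compare in blast)
  ultimately show ?thesis
    by (auto simp: has_asymptotic_density_def f_def[abs_def])
qed

lemma suminf_tail_tendsto_0:
  fixes f :: "nat \<Rightarrow> real"
  assumes "summable f"
  shows "(\<lambda>n. \<Sum>i. f (i + n)) \<longlonglongrightarrow> 0"
  by (rule LIMSEQ_I) (use suminf_exist_split[OF _ assms] in simp)

text \<open>Sieving by the first \<open>z\<close> blocks leaves a set with a density, and the later
  blocks remove at most a tail of the series of \<open>w\<close>. Index 0 sieves nothing and yields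
  the lower bound \<open>c - suminf w\<close>.\<close>

lemma density_free_of_summable:
  assumes dens: "has_asymptotic_density B c"
    and mult: "\<And>a b. a * b \<in> B \<longleftrightarrow> a \<in> B \<and> b \<in> B" and "0 \<notin> B"
    and fin: "\<And>j. finite (Q j)" and pos: "\<And>j q. q \<in> Q j \<Longrightarrow> q > 0"
    and w: "\<And>j. (\<Sum>q\<in>Q j. 1 / real q) \<le> w j" and "summable w"
  shows "\<exists>\<delta>. has_asymptotic_density (free_of (\<Union>j. Q j) B) \<delta> \<and> c - suminf w \<le> \<delta>"
proof -
  define A where "A z = free_of (\<Union>j<z. Q j) B" for z
  define e where "e z = (\<Sum>j. w (j + z))" for z
  have "0 \<le> (\<Sum>q\<in>Q j. 1 / real q)" for j
    by (intro sum_nonneg) simp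
  then have w0: "0 \<le> w j" for j
    using w order_trans by blast
  have "\<exists>d. has_asymptotic_density (A z) d" for z
    unfolding A_def by (rule density_free_of_finite[OF dens mult \<open>0 \<notin> B\<close>]) (use fin in simp)
  then obtain d where d: "\<And>z. has_asymptotic_density (A z) (d z)"
    by metis
  have "A 0 = B"
    by (simp add: A_def free_of_def)
  then have "d 0 = c"
    using d[of 0] dens tendsto_unique[OF trivial_limit_at_top_linorder]
    by (auto simp: has_asymptotic_density_def)
  have "e 0 = suminf w"
    by (simp add: e_def)
  have sub: "free_of (\<Union>j. Q j) B \<subseteq> A z" for z
    by (auto simp: A_def free_of_def)
  have diff: "counting_fun (A z) x - counting_fun (free_of (\<Union>j. Q j) B) x \<le> e z * x"
    if "x > 0" for z x
  proof -
    define X where "X = {k \<in> A z - free_of (\<Union>j. Q j) B. 1 \<le> k \<and> real k \<le> x}"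
    have "finite X"
      unfolding X_def One_nat_def by (rule finite_counting_set)
    have "\<exists>j q. q \<in> Q (j + z) \<and> q dvd k" if "k \<in> X" for k
    proof -
      have "k \<in> B" "\<forall>j<z. \<forall>q\<in>Q j. \<not> q dvd k" "\<exists>j. \<exists>q\<in>Q j. q dvd k"
        using that by (auto simp: X_def A_def free_of_def)
      then obtain j q where "q \<in> Q j" "q dvd k" "j \<ge> z"
        by (metis not_less)
      then show ?thesis by (metis le_add_diff_inverse2)
    qed
    \<comment> \<open>Only finitely many integers up to \<open>x\<close> are removed, so the
      finitely many blocks in \<open>h\<close> applied to \<open>X\<close> account for them and
      finite subadditivity suffices.\<close>
    then obtain h where h: "\<And>k. k \<in> X \<Longrightarrow> \<exists>q. q \<in> Q (h k + z) \<and> q dvd k"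
      by metis
    have "counting_fun (A z) x - counting_fun (free_of (\<Union>j. Q j) B) x
        = counting_fun (A z - free_of (\<Union>j. Q j) B) x"
      by (simp add: counting_fun_Diff[OF sub])
    also have "\<dots> = counting_fun X x"
      unfolding counting_fun_def X_def by (intro arg_cong[where f = "\<lambda>S. real (card S)"]) auto
    also have "\<dots> \<le> counting_fun (\<Union>i\<in>h ` X. \<Union>q\<in>Q (i + z). {k. q dvd k}) x"
      by (rule counting_fun_mono) (use h in blast)
    also have "\<dots> \<le> (\<Sum>i\<in>h ` X. counting_fun (\<Union>q\<in>Q (i + z). {k. q dvd k}) x)"
      by (rule counting_fun_UN_le) (use \<open>finite X\<close> in simp)
    also have "\<dots> \<le> (\<Sum>i\<in>h ` X. w (i + z) * x)"
    proof (rule sum_mono)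
      fix i
      have "counting_fun (\<Union>q\<in>Q (i + z). {k. q dvd k}) x
          \<le> (\<Sum>q\<in>Q (i + z). counting_fun {k. q dvd k} x)"
        by (rule counting_fun_UN_le[OF fin])
      also have "\<dots> \<le> (\<Sum>q\<in>Q (i + z). x / real q)"
        using \<open>x > 0\<close> pos by (intro sum_mono counting_fun_multiples_le) auto
      also have "\<dots> = (\<Sum>q\<in>Q (i + z). 1 / real q) * x"
        by (simp add: sum_distrib_right)
      also have "\<dots> \<le> w (i + z) * x"
        using w \<open>x > 0\<close> by (intro mult_right_mono) auto
      finally show "counting_fun (\<Union>q\<in>Q (i + z). {k. q dvd k}) x \<le> w (i + z) * x" .
    qed
    also have "\<dots> = (\<Sum>i\<in>h ` X. w (i + z)) * x"
      by (simp add: sum_distrib_right)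
    also have "\<dots> \<le> e z * x"
      unfolding e_def using \<open>finite X\<close> \<open>x > 0\<close> w0 \<open>summable w\<close>
      by (intro mult_right_mono sum_le_suminf) (auto simp: summable_iff_shift)
    finally show ?thesis .
  qed
  have "e \<longlonglongrightarrow> 0"
    unfolding e_def by (rule suminf_tail_tendsto_0[OF \<open>summable w\<close>])
  from density_approximation[OF d sub diff this]
  show ?thesis
    using \<open>d 0 = c\<close> \<open>e 0 = suminf w\<close> by metis
qed

subsection \<open>Removing small primes\<close>

text \<open>The members divisible by \<open>p\<close> form a copy of the whole set dilated by
  \<open>p\<close>, of density \<open>d / p\<close>.\<close>

lemma density_beurling_remove_prime:
  assumes primes: "\<forall>p\<in>P. prime p" and "p \<in> P"
    and dens: "has_asymptotic_density (beurling_integers P) d"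
  shows "has_asymptotic_density (beurling_integers (P - {p})) (d * (1 - 1 / real p))"
proof -
  let ?B = "beurling_integers P"
  have "prime p" using assms by blast
  moreover have "q = p" if "prime q" "q dvd p" for q
    using that \<open>prime p\<close> primes_dvd_imp_eq by blast
  ultimately have "p \<in> ?B"
    using \<open>p \<in> P\<close> prime_gt_0_nat[of p] by (auto simp: beurling_integers_eq[OF primes])
  then have sub: "(*) p ` ?B \<subseteq> ?B"
    by (auto simp: beurling_integers_mult_iff[OF primes])
  have "beurling_integers (P - {p}) = ?B - (*) p ` ?B"
  proof (intro set_eqI iffI)
    fix n assume "n \<in> beurling_integers (P - {p})"
    then have "n \<in> ?B" "\<not> p dvd n"
      using primes \<open>prime p\<close> by (auto simp: beurling_integers_eq)
    then show "n \<in> ?B - (*) p ` ?B" by auto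
  next
    fix n assume n: "n \<in> ?B - (*) p ` ?B"
    have "\<not> p dvd n"
    proof
      assume "p dvd n"
      then obtain m where "n = p * m" ..
      with n show False by (auto simp: beurling_integers_mult_iff[OF primes])
    qed
    then show "n \<in> beurling_integers (P - {p})"
      using n primes by (auto simp: beurling_integers_eq)
  qed
  moreover have "d * (1 - 1 / real p) = d - d / real p"
    by (simp add: algebra_simps)
  ultimately show ?thesis
    using has_asymptotic_density_Diff[OF dens has_asymptotic_density_dilate[OF dens] sub]
      prime_gt_0_nat[OF \<open>prime p\<close>] by simp
qed

text \<open>Passing from \<open>y\<close> to \<open>y + 1\<close> costs at most the factor
  \<open>y / (y + 1)\<close>, and these factors telescope. The crude loss is affordable because the
  later sieve removes only \<open>exp 1 / fact N\<close> when \<open>y = 2 ^ N\<close>.\<close>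

lemma density_beurling_large_primes:
  assumes primes: "\<forall>p\<in>P. prime p"
    and dens: "has_asymptotic_density (beurling_integers P) c" and "c \<ge> 0" "y \<ge> 1"
  shows "\<exists>d \<ge> c / real y. has_asymptotic_density (beurling_integers (P \<inter> {y<..})) d"
  using \<open>y \<ge> 1\<close>
proof (induction y rule: dec_induct)
  case base
  have "P \<inter> {1<..} = P"
    using primes prime_gt_1_nat by auto
  then show ?case using dens by auto
next
  case (step y)
  then obtain d where d: "d \<ge> c / real y" "has_asymptotic_density (beurling_integers (P \<inter> {y<..})) d"
    by blast
  show ?case
  proof (cases "Suc y \<in> P")
    case True
    have "P \<inter> {Suc y<..} = P \<inter> {y<..} - {Suc y}"
      by auto
    then have "has_asymptotic_density (beurling_integers (P \<inter> {Suc y<..})) (d * (1 - 1 / real (Suc y)))"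
      using density_beurling_remove_prime[of "P \<inter> {y<..}" "Suc y" d] primes d True by simp
    moreover have "c / real (Suc y) = c / real y * (1 - 1 / real (Suc y))"
      using step by (simp add: field_simps)
    then have "c / real (Suc y) \<le> d * (1 - 1 / real (Suc y))"
      using mult_right_mono[OF d(1), of "1 - 1 / real (Suc y)"] by simp
    ultimately show ?thesis by blast
  next
    case False
    then have "x > Suc y \<longleftrightarrow> x > y" if "x \<in> P" for x
      using that by (cases "x = Suc y") auto
    then have "P \<inter> {Suc y<..} = P \<inter> {y<..}"
      by auto
    moreover have "c / real (Suc y) \<le> c / real y"
      using step \<open>c \<ge> 0\<close> by (intro divide_left_mono) auto
    ultimately show ?thesis using d order_trans by auto
  qed
qed

subsection \<open>Sparse products of large integers\<close>

text \<open>
  The length \<open>j\<close> of a product from the \<open>j\<close>-th dyadic block is a compromise: the reciprocals of these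
  products add up to at most \<open>1 / j!\<close>, while a number divisible by none of them has fewer than \<open>j\<close>
  prime factors in the block, which contribute at most \<open>j / 2 ^ j\<close> to \<open>\<Sum> 1 / p\<close>.
\<close>

definition block_products :: "nat \<Rightarrow> nat set" where
  "block_products j = Prod ` {S. S \<subseteq> {2 ^ j<..2 ^ Suc j} \<and> card S = j}"

lemma finite_block_subsets: "finite {S. S \<subseteq> {2 ^ j<..2 ^ Suc j :: nat} \<and> card S = j}"
  by (rule finite_subset[of _ "Pow {2 ^ j<..2 ^ Suc j}"]) auto

lemma finite_block_products: "finite (block_products j)"
  unfolding block_products_def by (rule finite_imageI[OF finite_block_subsets])

lemma prod_block_subset_ge:
  fixes S :: "nat set"
  assumes "S \<subseteq> {2 ^ j<..2 ^ Suc j}" "card S = j"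
  shows "(2 ^ j) ^ j \<le> \<Prod>S"
proof -
  have "(\<Prod>p\<in>S. 2 ^ j) \<le> \<Prod>S"
    using assms by (intro prod_mono) auto
  then show ?thesis using assms by simp
qed

lemma block_products_pos:
  assumes "q \<in> block_products j"
  shows "q > 0"
proof -
  obtain S where "q = \<Prod>S" "S \<subseteq> {2 ^ j<..2 ^ Suc j}" "card S = j"
    using assms unfolding block_products_def by blast
  then have "(2 ^ j) ^ j \<le> q"
    using prod_block_subset_ge by blast
  moreover have "(0::nat) < (2 ^ j) ^ j"
    by simp
  ultimately show ?thesis by linarith
qed

text \<open>The block holds \<open>2 ^ j\<close> integers, so there are at most
  \<open>(2 ^ j) ^ j / fact j\<close> choices of \<open>S\<close>, each with product at least
  \<open>(2 ^ j) ^ j\<close>.\<close>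

lemma sum_inverse_block_products: "(\<Sum>q\<in>block_products j. 1 / real q) \<le> 1 / fact j"
proof -
  let ?T = "{S. S \<subseteq> {2 ^ j<..2 ^ Suc j :: nat} \<and> card S = j}"
  \<comment> \<open>Only an inequality, since different subsets may share a product.\<close>
  have "(\<Sum>q\<in>block_products j. 1 / real q) \<le> (\<Sum>S\<in>?T. 1 / real (\<Prod>S))"
    unfolding block_products_def
    using sum_image_le[OF finite_block_subsets[of j], of "\<lambda>q. 1 / real q" Prod] by (simp add: o_def prod_nonneg)
  also have "\<dots> \<le> (\<Sum>S\<in>?T. 1 / (2 ^ j) ^ j)"
  proof (rule sum_mono)
    fix S assume "S \<in> ?T"
    then have "real ((2 ^ j) ^ j) \<le> real (\<Prod>S)"
      using prod_block_subset_ge by (intro of_nat_mono) auto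
    then show "1 / real (\<Prod>S) \<le> 1 / (2 ^ j) ^ j"
      by (intro frac_le) (simp_all del: of_nat_prod)
  qed
  also have "\<dots> = real (2 ^ j choose j) / (2 ^ j) ^ j"
    using n_subsets[of "{2 ^ j<..2 ^ Suc j :: nat}" j] by simp
  also have "\<dots> \<le> 1 / fact j"
  proof -
    have "real ((2 ^ j choose j) * fact j) \<le> real ((2 ^ j) ^ j)"
      by (intro of_nat_mono binomial_fact_pow)
    then show ?thesis by (simp add: field_simps)
  qed
  finally show ?thesis .
qed

lemma summable_linear_over_power2: "summable (\<lambda>j. real j / 2 ^ j)"
proof (rule summable_comparison_test')
  show "summable (\<lambda>j. of_nat (Suc j) * (1 / 2 :: real) ^ j)"
    by (rule sums_summable[OF geometric_deriv_sums]) simp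
  show "norm (real j / 2 ^ j) \<le> of_nat (Suc j) * (1 / 2 :: real) ^ j" for j
    by (simp add: field_simps)
qed

lemma sum_inverse_prime_factors_le:
  assumes "k > 0" and large: "\<And>p. p \<in> prime_factors k \<Longrightarrow> p > 2 ^ N"
    and free: "\<And>j q. q \<in> block_products (j + N) \<Longrightarrow> \<not> q dvd k"
  shows "(\<Sum>p\<in>prime_factors k. 1 / real p) \<le> (\<Sum>j. real (j + N) / 2 ^ (j + N))"
proof -
  let ?F = "prime_factors k"
  have "\<exists>i. p \<in> {2 ^ (i + N)<..2 ^ Suc (i + N)}" if p: "p \<in> ?F" for p
  proof -
    have "p \<ge> 2"
      using p prime_ge_2_nat by (auto simp: in_prime_factors_iff)
    \<comment> \<open>The interval is half-open like the blocks, and \<open>p > 2 ^ N\<close> forces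
      \<open>n \<ge> N\<close>.\<close>
    then obtain n where n: "2 ^ n < p" "p \<le> 2 ^ (n + 1)"
      using ex_power_ivl2[of 2 p] by auto
    then have "(2::nat) ^ N < 2 ^ (n + 1)"
      using large[OF p] by linarith
    then have "N \<le> n"
      by (simp only: power_strict_increasing_iff)
    then show ?thesis
      using n by (intro exI[of _ "n - N"]) simp
  qed
  then obtain h where h: "\<And>p. p \<in> ?F \<Longrightarrow> p \<in> {2 ^ (h p + N)<..2 ^ Suc (h p + N)}"
    by metis
  have block: "(\<Sum>p | p \<in> ?F \<and> h p = i. 1 / real p) \<le> real (i + N) / 2 ^ (i + N)" for i
  proof -
    let ?S = "{p \<in> ?F. h p = i}"
    have "card ?S \<le> i + N"
    proof (rule ccontr)
      assume "\<not> card ?S \<le> i + N"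
      then obtain T where T: "T \<subseteq> ?S" "card T = i + N"
        using obtain_subset_with_card_n[of "i + N" ?S] by auto
      then have "\<Prod>T \<in> block_products (i + N)"
        unfolding block_products_def using h by (intro imageI) blast
      moreover have "\<Prod>T dvd k"
        using T by (intro prod_subset_prime_factors_dvd) auto
      ultimately show False using free by blast
    qed
    have "(\<Sum>p\<in>?S. 1 / real p) \<le> (\<Sum>p\<in>?S. 1 / 2 ^ (i + N))"
    proof (rule sum_mono)
      fix p assume "p \<in> ?S"
      then have "real (2 ^ (i + N)) \<le> real p"
        using h by (intro of_nat_mono) fastforce
      then show "1 / real p \<le> 1 / 2 ^ (i + N)"
        by (intro frac_le) simp_all
    qed
    also have "\<dots> = real (card ?S) / 2 ^ (i + N)"
      by simp
    also have "\<dots> \<le> real (i + N) / 2 ^ (i + N)"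
      using \<open>card ?S \<le> i + N\<close> by (intro divide_right_mono of_nat_mono) auto
    finally show ?thesis .
  qed
  have "(\<Sum>p\<in>?F. 1 / real p) = (\<Sum>i\<in>h ` ?F. \<Sum>p | p \<in> ?F \<and> h p = i. 1 / real p)"
    by (rule sum.group[symmetric]) auto
  also have "\<dots> \<le> (\<Sum>i\<in>h ` ?F. real (i + N) / 2 ^ (i + N))"
    by (rule sum_mono[OF block])
  also have "\<dots> \<le> (\<Sum>j. real (j + N) / 2 ^ (j + N))"
    using summable_iff_shift[of "\<lambda>j. real j / 2 ^ j" N] summable_linear_over_power2
    by (intro sum_le_suminf) auto
  finally show ?thesis .
qed

text \<open>Since \<open>fact j * fact N\<close> divides \<open>fact (j + N)\<close>, the
  exponential series at 1 scaled by \<open>1 / fact N\<close> dominates.\<close>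

lemma suminf_inverse_fact_shift_le:
  "summable (\<lambda>j. 1 / fact (j + N) :: real)" "(\<Sum>j. 1 / fact (j + N) :: real) \<le> exp 1 / fact N"
proof -
  have sums: "(\<lambda>j. 1 / fact j * (1 / fact N) :: real) sums (exp 1 * (1 / fact N))"
    using exp_converges[of "1 :: real"] by (intro sums_mult2) (simp add: scaleR_conv_of_real divide_inverse)
  have le: "1 / fact (j + N) \<le> (1 / fact j * (1 / fact N) :: real)" for j
  proof -
    have "fact j * fact N \<le> (fact (j + N) :: nat)"
      by (intro dvd_imp_le fact_fact_dvd_fact) simp
    then have "real (fact j * fact N) \<le> real (fact (j + N))"
      by (rule of_nat_mono)
    then show ?thesis
      by (simp add: field_simps)
  qed
  show sm: "summable (\<lambda>j. 1 / fact (j + N) :: real)"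
    by (rule summable_comparison_test'[OF sums_summable[OF sums]]) (use le in simp)
  show "(\<Sum>j. 1 / fact (j + N) :: real) \<le> exp 1 / fact N"
    using suminf_le[OF le sm sums_summable[OF sums]] sums_unique[OF sums] by simp
qed

section \<open>Choice of the cutoff and conclusion\<close>

lemma has_asymptotic_density_if_bigo:
  assumes "lam > 0"
    and "(\<lambda>x. counting_fun A x - c * x) \<in> O[at_top](\<lambda>x. x / (ln x) powr lam)"
  shows "has_asymptotic_density A c"
proof -
  \<comment> \<open>This is the error term divided by \<open>x\<close>.\<close>
  have "((\<lambda>x. (ln x) powr (- lam)) \<longlongrightarrow> 0) at_top"
    using assms(1) by (intro tendsto_neg_powr ln_at_top) simp
  then have "((\<lambda>x. x / (ln x) powr lam / x) \<longlongrightarrow> 0) at_top"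
    by (rule Lim_transform_eventually)
      (use eventually_gt_at_top[of 0] in eventually_elim, simp add: powr_minus divide_inverse)
  then have "(\<lambda>x. x / (ln x) powr lam) \<in> o[at_top](\<lambda>x. x)"
    by (rule smalloI_tendsto) (use eventually_gt_at_top[of 0] in eventually_elim, simp)
  then have "((\<lambda>x. (counting_fun A x - c * x) / x) \<longlongrightarrow> 0) at_top"
    using assms(2) landau_o.big_small_trans smalloD_tendsto by blast
  then have "((\<lambda>x. (counting_fun A x - c * x) / x + c) \<longlongrightarrow> 0 + c) at_top"
    by (intro tendsto_add tendsto_const)
  then have "((\<lambda>x. counting_fun A x / x) \<longlongrightarrow> 0 + c) at_top"
    by (rule Lim_transform_eventually)
      (use eventually_gt_at_top[of 0] in eventually_elim, simp add: field_simps)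
  then show ?thesis by (simp add: has_asymptotic_density_def)
qed

text \<open>
  The first inequality keeps the density positive after sieving; the second makes \<open>\<Sum> 1 / p\<close> small.
\<close>

lemma exists_cutoff:
  fixes c \<eta> :: real
  assumes "c > 0" "\<eta> > 0"
  shows "\<exists>N. exp 1 / fact N < c / 2 ^ N \<and> (\<Sum>j. real (j + N) / 2 ^ (j + N)) < \<eta>"
proof -
  have "(\<lambda>N. exp 1 * (inverse (fact N) * 2 ^ N) :: real) \<longlonglongrightarrow> exp 1 * 0"
    by (intro tendsto_mult tendsto_const summable_LIMSEQ_zero summable_exp)
  then have "\<forall>\<^sub>F N in sequentially. exp 1 * (inverse (fact N) * 2 ^ N) < c"
    using assms by (intro order_tendstoD(2)) auto
  moreover have "(\<lambda>N. \<Sum>j. real (j + N) / 2 ^ (j + N)) \<longlonglongrightarrow> 0"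
    by (rule suminf_tail_tendsto_0[OF summable_linear_over_power2])
  then have "\<forall>\<^sub>F N in sequentially. (\<Sum>j. real (j + N) / 2 ^ (j + N)) < \<eta>"
    using assms by (intro order_tendstoD(2)) auto
  ultimately have "\<forall>\<^sub>F N in sequentially.
      exp 1 * (inverse (fact N) * 2 ^ N) < c \<and> (\<Sum>j. real (j + N) / 2 ^ (j + N)) < \<eta>"
    by (rule eventually_conj)
  then obtain N where "exp 1 * (inverse (fact N) * 2 ^ N) < c" "(\<Sum>j. real (j + N) / 2 ^ (j + N)) < \<eta>"
    using eventually_happens trivial_limit_sequentially by blast
  then show ?thesis
    by (intro exI[of _ N]) (simp add: field_simps)
qed

theorem theorem3p1:
  fixes P :: "nat set" and c lam :: real
  assumes "\<forall>p \<in> P. prime p"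
    and "c > 0" and "lam > 0"
    and "(\<lambda>x. counting_fun (beurling_integers P) x - c * x) \<in> O[at_top](\<lambda>x. x / (ln x) powr lam)"
  shows "\<forall>\<epsilon>::real. 0 < \<epsilon> \<and> \<epsilon> < 1 \<longrightarrow>
    (\<exists>B\<^sub>\<epsilon> \<subseteq> beurling_integers P.
       (\<exists>\<alpha>>0. has_asymptotic_density B\<^sub>\<epsilon> \<alpha>) \<and>
       (\<forall>(s::nat) (r::nat) (k::nat). s \<ge> 1 \<longrightarrow> r \<ge> 2 \<longrightarrow> k \<in> B\<^sub>\<epsilon> \<longrightarrow> k \<ge> 2 \<longrightarrow>
          norm (1 / of_nat (k ^ (s * (r + 1))) *
                  (\<Sum>j = 1..k ^ s. of_nat j ^ r * cohen_ramanujan_sum s k (int j))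
                - of_real (jordan_totient s k / real k ^ s - 1 / (real r + 1))) < \<epsilon>))"
proof (intro allI impI)
  fix \<epsilon> :: real assume \<epsilon>: "0 < \<epsilon> \<and> \<epsilon> < 1"
  \<comment> \<open>\<open>N\<close> is chosen before \<open>s\<close>, \<open>r\<close> and
    \<open>k\<close>, so one set serves them all. The threshold \<open>ln (1 + \<epsilon>)\<close>
    turns the moment bound \<open>exp S - 1\<close> into one below \<epsilon>, where
    \<open>S\<close> is the sum of \<open>1 / p\<close>.\<close>
  then obtain N where N: "exp 1 / fact N < c / 2 ^ N"
    and tail: "(\<Sum>j. real (j + N) / 2 ^ (j + N)) < ln (1 + \<epsilon>)"
    using exists_cutoff[of c "ln (1 + \<epsilon>)"] \<open>c > 0\<close> by auto
  define P' where "P' = P \<inter> {2 ^ N<..}"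
  define B' where "B' = beurling_integers P'"
  define X where "X = free_of (\<Union>j. block_products (j + N)) B'"
  have P': "\<forall>p\<in>P'. prime p" using assms(1) by (simp add: P'_def)
  have "1 \<le> (2::nat) ^ N" by simp
  from density_beurling_large_primes[OF assms(1) has_asymptotic_density_if_bigo[OF assms(3,4)] _ this]
  obtain d where d: "d \<ge> c / 2 ^ N" "has_asymptotic_density B' d"
    using \<open>c > 0\<close> by (auto simp: B'_def P'_def)
  have "0 \<notin> B'"
    by (simp add: B'_def beurling_integers_eq[OF P'])
  have "\<exists>\<delta>. has_asymptotic_density X \<delta> \<and> d - (\<Sum>j. 1 / fact (j + N)) \<le> \<delta>"
    unfolding X_def
  proof (rule density_free_of_summable[OF d(2)])
    show "a * b \<in> B' \<longleftrightarrow> a \<in> B' \<and> b \<in> B'" for a b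
      unfolding B'_def by (rule beurling_integers_mult_iff[OF P'])
  qed (fact \<open>0 \<notin> B'\<close> | rule finite_block_products sum_inverse_block_products
      suminf_inverse_fact_shift_le | erule block_products_pos)+
  then obtain \<delta> where \<delta>: "has_asymptotic_density X \<delta>" "d - (\<Sum>j. 1 / fact (j + N)) \<le> \<delta>"
    by blast
  \<comment> \<open>The density is at least \<open>c / 2 ^ N - exp 1 / fact N\<close>, positive by
    the choice of \<open>N\<close>.\<close>
  have "\<delta> > 0"
    using \<delta>(2) suminf_inverse_fact_shift_le(2)[of N] N d(1) by linarith
  have "X \<subseteq> beurling_integers P"
    using P' assms(1) by (auto simp: X_def free_of_def B'_def P'_def beurling_integers_eq)
  moreover have "norm (1 / of_nat (k ^ (s * (r + 1))) *
        (\<Sum>j = 1..k ^ s. of_nat j ^ r * cohen_ramanujan_sum s k (int j))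
      - of_real (jordan_totient s k / real k ^ s - 1 / (real r + 1))) < \<epsilon>"
    if "s \<ge> 1" "k \<in> X" "k \<ge> 2" for s r k :: nat
  proof -
    have "(\<Sum>p\<in>prime_factors k. 1 / real p) \<le> (\<Sum>j. real (j + N) / 2 ^ (j + N))"
    proof (rule sum_inverse_prime_factors_le)
      show "p > 2 ^ N" if "p \<in> prime_factors k" for p
      proof -
        have "p \<in> P'"
          using \<open>k \<in> X\<close> that
          by (auto simp: X_def free_of_def B'_def beurling_integers_eq[OF P'] in_prime_factors_iff)
        then show ?thesis by (simp add: P'_def)
      qed
      show "\<not> q dvd k" if "q \<in> block_products (j + N)" for j q
        using \<open>k \<in> X\<close> that by (auto simp: X_def free_of_def)
    qed (use that in auto)
    then have "(\<Sum>p\<in>prime_factors k. 1 / real p) < ln (1 + \<epsilon>)"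
      using tail by linarith
    then have "exp (\<Sum>p\<in>prime_factors k. 1 / real p) < 1 + \<epsilon>"
      using \<epsilon> exp_less_mono[of _ "ln (1 + \<epsilon>)"] by simp
    then show ?thesis
      using cohen_ramanujan_moment_approx[OF \<open>s \<ge> 1\<close> \<open>k \<ge> 2\<close>, of r] by linarith
  qed
  ultimately show "\<exists>B\<^sub>\<epsilon> \<subseteq> beurling_integers P.
       (\<exists>\<alpha>>0. has_asymptotic_density B\<^sub>\<epsilon> \<alpha>) \<and>
       (\<forall>(s::nat) (r::nat) (k::nat). s \<ge> 1 \<longrightarrow> r \<ge> 2 \<longrightarrow> k \<in> B\<^sub>\<epsilon> \<longrightarrow> k \<ge> 2 \<longrightarrow>
          norm (1 / of_nat (k ^ (s * (r + 1))) *
                  (\<Sum>j = 1..k ^ s. of_nat j ^ r * cohen_ramanujan_sum s k (int j))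
                - of_real (jordan_totient s k / real k ^ s - 1 / (real r + 1))) < \<epsilon>)"
    using \<delta>(1) \<open>\<delta> > 0\<close> by blast
qed

end
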